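(* Let $n\ge 1$ be an integer, let $\mathcal{H}$ be a complex Hilbert space, and let $f \in \mathcal{D}(\mathbb{D}^n,\mathcal{H})$ with coefficients $(a_\alpha)_{\alpha\in\mathbb{N}^n}$. Then for quasi-every $\theta \in [0,2\pi)^n$, the series $f(\theta)\sim\sum_{\alpha\in\mathbb{N}^n} a_\alpha e^{i(\alpha,\theta)}$ converges in the sense of Pringsheim.
   Context: Notation: $\mathbb{N}=\{0,1,2,\dots\}$; $(\alpha,\theta)=\alpha_1\theta_1+\cdots+\alpha_n\theta_n$. The set $[0,2\pi)^n$ is identified with the $n$-torus $\mathbb{T}^n$ via $\theta\mapsto(e^{i\theta_1},\dots,e^{i\theta_n})$, and $d\psi$ denotes normalized Lebesgue measure on $\mathbb{T}^n$. Dirichlet space: a multiple Fourier series $f(\theta)\sim\sum_{\alpha\in\mathbb{N}^n}a_\alpha e^{i(\alpha,\theta)}$ with coefficients $a_\alpha\in\mathcal{H}$ belongs to $\mathcal{D}(\mathbb{D}^n,\mathcal{H})$ if $\sum_{\alpha\in\mathbb{N}^n}(\alpha_1+1)\cdots(\alpha_n+1)\|a_\alpha\|_{\mathcal{H}}^2<\infty$. Capacity: for a positive measurable function $g$ on $\mathbb{T}^n$ let $$Bg(\theta)=\int_{\mathbb{T}^n}\frac{1}{|e^{i\theta_1}-e^{i\psi_1}|^{1/2}}\cdots\frac{1}{|e^{i\theta_n}-e^{i\psi_n}|^{1/2}}\,g(\psi)\,d\psi\in[0,\infty].$$ For a set $E\subset\mathbb{T}^n$ let $C(E)=\inf\{\|g\|_{L^2(\mathbb{T}^n)}^2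 : g\ge 0,\ Bg(\theta)\ge 1 \text{ for all } \theta\in E\}$. A property holds quasi-everywhere (for quasi-every $\theta$) if it holds for all $\theta\in\mathbb{T}^n$ outside a set $E$ with $C(E)=0$. Pringsheim convergence: the series $f(\theta)$ converges in the sense of Pringsheim (at the given $\theta$) if the rectangular partial sums $\sum_{\alpha_1=0}^{N_1}\cdots\sum_{\alpha_n=0}^{N_n}a_\alpha e^{i(\alpha,\theta)}$ converge in $\mathcal{H}$ as $N\in\mathbb{N}^n$, $N\to\infty$, where $N\to\infty$ means $\min_{1\le j\le n}N_j\to\infty$ with no assumption on the relationship between the $N_j$, and in addition $\sup_{N\in\mathbb{N}^n}\bigl\|\sum_{\alpha_1=0}^{N_1}\cdots\sum_{\alpha_n=0}^{N_n}a_\alpha e^{i(\alpha,\theta)}\bigr\|_{\mathcal{H}}<\infty$. *)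

theory Defs
  imports "HOL-Analysis.Analysis"
begin

text \<open>The inner product is linear in its first argument. Completeness comes from \<^class>\<open>banach\<close>;
  the last axiom ties the inner product to the existing norm and gives positive definiteness.\<close>

class complex_hilbert_space = banach +
  fixes scaleC :: "complex \<Rightarrow> 'a \<Rightarrow> 'a"  (infixr \<open>*\<^sub>C\<close> 75)
    and cinner :: "'a \<Rightarrow> 'a \<Rightarrow> complex"
  assumes scaleC_add_right: "c *\<^sub>C (x + y) = c *\<^sub>C x + c *\<^sub>C y"
    and scaleC_add_left: "(c + d) *\<^sub>C x = c *\<^sub>C x + d *\<^sub>C x"
    and scaleC_scaleC: "c *\<^sub>C d *\<^sub>C x = (c * d) *\<^sub>C x"
    and scaleC_of_real: "complex_of_real r *\<^sub>C x = r *\<^sub>R x"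
    and cinner_commute: "cinner x y = cnj (cinner y x)"
    and cinner_add_left: "cinner (x + y) z = cinner x z + cinner y z"
    and cinner_scaleC_left: "cinner (c *\<^sub>C x) y = c * cinner x y"
    and cinner_self: "cinner x x = complex_of_real ((norm x)\<^sup>2)"

instantiation complex :: complex_hilbert_space
begin

definition scaleC_complex :: "complex \<Rightarrow> complex \<Rightarrow> complex"
  where "scaleC_complex c x = c * x"

definition cinner_complex :: "complex \<Rightarrow> complex \<Rightarrow> complex"
  where "cinner_complex x y = x * cnj y"

instance
proof
  fix x :: complex
  show "cinner x x = complex_of_real ((norm x)\<^sup>2)"
    unfolding cinner_complex_def by (rule complex_norm_square [symmetric])
qed (simp_all add: scaleC_complex_def cinner_complex_def distrib_left distrib_right
  scaleR_conv_of_real)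

end

text \<open>Points of \<open>\<nat>\<^sup>n\<close> and \<open>[0, 2\<pi>)\<^sup>n\<close> are functions on \<open>{..<n}\<close>, extended by \<^term>\<open>undefined\<close>.\<close>

definition multi_indices :: "nat \<Rightarrow> (nat \<Rightarrow> nat) set"
  where "multi_indices n = {..<n} \<rightarrow>\<^sub>E UNIV"

definition torus :: "nat \<Rightarrow> (nat \<Rightarrow> real) set"
  where "torus n = {..<n} \<rightarrow>\<^sub>E {0..<2 * pi}"

text \<open>The underlying space is all of \<open>\<real>\<^sup>n\<close>, but the complement of the torus is a null set. Because
  of the completion, neither measurability nor integrals depend on the values of a function there.\<close>

definition torus_measure :: "nat \<Rightarrow> (nat \<Rightarrow> real) measure"
  where "torus_measure n =
    completion (\<Pi>\<^sub>M j\<in>{..<n}. uniform_measure lborel {0..<2 * pi})"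

text \<open>The division is the one of \<^typ>\<open>ennreal\<close>, so the kernel is \<open>\<infinity>\<close> where a factor is singular.\<close>

definition potential :: "nat \<Rightarrow> ((nat \<Rightarrow> real) \<Rightarrow> ennreal) \<Rightarrow> (nat \<Rightarrow> real) \<Rightarrow> ennreal"
  where "potential n g \<theta> =
    (\<integral>\<^sup>+ \<psi>. (\<Prod>j<n. 1 / ennreal (cmod (cis (\<theta> j) - cis (\<psi> j)) powr (1 / 2))) * g \<psi>
      \<partial>torus_measure n)"

definition capacity :: "nat \<Rightarrow> (nat \<Rightarrow> real) set \<Rightarrow> ennreal"
  where "capacity n E =
    Inf {(\<integral>\<^sup>+ \<psi>. (g \<psi>)\<^sup>2 \<partial>torus_measure n) | g.
      g \<in> borel_measurable (torus_measure n) \<and> (\<forall>\<theta>\<in>E. potential n g \<theta> \<ge> 1)}"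

definition quasi_everywhere :: "nat \<Rightarrow> ((nat \<Rightarrow> real) \<Rightarrow> bool) \<Rightarrow> bool"
  where "quasi_everywhere n P \<longleftrightarrow>
    (\<exists>E \<subseteq> torus n. capacity n E = 0 \<and> (\<forall>\<theta>\<in>torus n - E. P \<theta>))"

text \<open>A series is represented by its family of coefficients; only those at multi-indices matter.\<close>

definition dirichlet_space :: "nat \<Rightarrow> ((nat \<Rightarrow> nat) \<Rightarrow> 'h::complex_hilbert_space) set"
  where "dirichlet_space n =
    {a. (\<lambda>\<alpha>. (\<Prod>j<n. real (\<alpha> j + 1)) * (norm (a \<alpha>))\<^sup>2) summable_on multi_indices n}"

definition rect_partial_sum ::
    "nat \<Rightarrow> ((nat \<Rightarrow> nat) \<Rightarrow> 'h::complex_hilbert_space) \<Rightarrow> (nat \<Rightarrow> real) \<Rightarrow> (nat \<Rightarrow> nat) \<Rightarrow> 'h"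
  where "rect_partial_sum n a \<theta> N =
    (\<Sum>\<alpha>\<in>(\<Pi>\<^sub>E j\<in>{..<n}. {..N j}). cis (\<Sum>j<n. real (\<alpha> j) * \<theta> j) *\<^sub>C a \<alpha>)"

definition pringsheim_at_top :: "nat \<Rightarrow> (nat \<Rightarrow> nat) filter"
  where "pringsheim_at_top n =
    inf (filtercomap (\<lambda>N. MIN j\<in>{..<n}. N j) at_top) (principal (multi_indices n))"

definition pringsheim_convergent ::
    "nat \<Rightarrow> ((nat \<Rightarrow> nat) \<Rightarrow> 'h::complex_hilbert_space) \<Rightarrow> (nat \<Rightarrow> real) \<Rightarrow> bool"
  where "pringsheim_convergent n a \<theta> \<longleftrightarrow>
    (\<exists>s. (rect_partial_sum n a \<theta> \<longlongrightarrow> s) (pringsheim_at_top n)) \<and>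
    bdd_above ((\<lambda>N. norm (rect_partial_sum n a \<theta> N)) ` multi_indices n)"

end

theory Submission
  imports Defs "HOL-Probability.Infinite_Product_Measure"
begin

text \<open>Put \<open>b\<^sub>\<alpha> = \<surd>((\<alpha>\<^sub>1 + 1) \<cdots> (\<alpha>\<^sub>n + 1)) a\<^sub>\<alpha>\<close>, so that \<open>g = \<Sum> b\<^sub>\<alpha> e\<^sup>i\<^sup>(\<^sup>\<alpha>\<^sup>,\<^sup>\<psi>\<^sup>)\<close> is square integrable. A
  rectangular partial sum of \<open>f\<close> is the convolution of \<open>g\<close> with a product of one-dimensional kernels
  \<open>\<Sum>\<^bsub>k\<le>N\<^esub> e\<^sup>i\<^sup>k\<^sup>\<phi> / \<surd>(k + 1)\<close>, each bounded by \<open>4 |1 - e\<^sup>i\<^sup>\<phi>|\<^sup>-\<^sup>1\<^sup>/\<^sup>2\<close> uniformly in \<open>N\<close>. So \<open>4\<^sup>n\<close> times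
  the potential of \<open>|g|\<close> dominates all rectangular partial sums at once. Now cut \<open>f\<close> into blocks
  between growing cubes such that the \<open>L\<^sup>2\<close> norms of the corresponding pieces \<open>g\<^sub>m\<close> of \<open>g\<close> decay
  geometrically. Then \<open>w = \<Sum> |g\<^sub>m|\<close> is square integrable and its potential is finite off a set of
  capacity zero. Wherever it is finite, the bounds on the block sums are summable, which gives
  convergence and boundedness of the rectangular partial sums.\<close>

subsection \<open>The inner product\<close>

lemma cinner_add_right: "cinner x (y + z) = cinner x y + cinner x z"
  for x :: "'h::complex_hilbert_space"
  by (metis cinner_add_left cinner_commute complex_cnj_add)

lemma cinner_scaleC_right: "cinner x (c *\<^sub>C y) = cnj c * cinner x y"
  for x :: "'h::complex_hilbert_space"
  by (metis cinner_scaleC_left cinner_commute complex_cnj_mult)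

lemma cinner_0_left: "cinner 0 y = 0"
  for y :: "'h::complex_hilbert_space"
  using cinner_add_left[of 0 0 y] by simp

lemma cinner_0_right: "cinner y 0 = 0"
  for y :: "'h::complex_hilbert_space"
  using cinner_add_right[of y 0 0] by simp

lemma cinner_scaleR_left: "cinner (r *\<^sub>R x) y = of_real r * cinner x y"
  for x :: "'h::complex_hilbert_space"
  by (metis scaleC_of_real cinner_scaleC_left)

lemma cinner_sum_left: "cinner (sum f A) y = (\<Sum>i\<in>A. cinner (f i) y)"
  for y :: "'h::complex_hilbert_space"
  by (induction A rule: infinite_finite_induct) (simp_all add: cinner_0_left cinner_add_left)

lemma cinner_sum_right: "cinner y (sum f A) = (\<Sum>i\<in>A. cinner y (f i))"
  for y :: "'h::complex_hilbert_space"
  by (induction A rule: infinite_finite_induct) (simp_all add: cinner_0_right cinner_add_right)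

text \<open>The scalar \<open>c\<close> makes \<open>x + c *\<^sub>C y\<close> orthogonal to
  \<open>y\<close>; that the squared norm of this vector is nonnegative is the inequality.\<close>

lemma cinner_Cauchy_Schwarz: "cmod (cinner x y) \<le> norm x * norm y"
  for x y :: "'h::complex_hilbert_space"
proof (cases "y = 0")
  case False
  define c where "c = - cinner x y / of_real ((norm y)\<^sup>2)"
  have y: "(norm y)\<^sup>2 \<noteq> 0"
    using False by simp
  have "complex_of_real ((norm (x + c *\<^sub>C y))\<^sup>2) = cinner (x + c *\<^sub>C y) (x + c *\<^sub>C y)"
    by (simp add: cinner_self)
  also have "\<dots> = cinner x x + cnj c * cinner x y + c * (cinner y x + cnj c * cinner y y)"
    by (simp add: cinner_add_left cinner_add_right cinner_scaleC_left cinner_scaleC_right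
        algebra_simps)
  also have "cinner y x + cnj c * cinner y y = 0"
    using y by (simp add: c_def cinner_self cinner_commute[of y x])
  also have "cnj c * cinner x y = - (of_real ((cmod (cinner x y))\<^sup>2 / (norm y)\<^sup>2))"
    by (simp add: c_def complex_norm_square mult.commute del: of_real_power)
  finally have "complex_of_real ((norm (x + c *\<^sub>C y))\<^sup>2)
      = complex_of_real ((norm x)\<^sup>2 - (cmod (cinner x y))\<^sup>2 / (norm y)\<^sup>2)"
    by (simp add: cinner_self)
  then have "(norm (x + c *\<^sub>C y))\<^sup>2 = (norm x)\<^sup>2 - (cmod (cinner x y))\<^sup>2 / (norm y)\<^sup>2"
    using of_real_eq_iff by blast
  then have "(cmod (cinner x y))\<^sup>2 / (norm y)\<^sup>2 \<le> (norm x)\<^sup>2"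
    by (metis diff_ge_0_iff_ge zero_le_power2)
  then have "(cmod (cinner x y))\<^sup>2 \<le> (norm x * norm y)\<^sup>2"
    using y by (simp add: field_simps power_mult_distrib)
  then show ?thesis
    by (rule power2_le_imp_le) simp
qed (simp add: cinner_0_right)

subsection \<open>The one-dimensional kernels\<close>

text \<open>Partial sums of a series with a singularity of order |1 - z|^(-1/2) at z = 1, which
  matches one factor of the capacity kernel. The coefficients invert the square roots of the
  Dirichlet weights in one variable.\<close>

definition kernel_sum :: "nat \<Rightarrow> real \<Rightarrow> complex"
  where "kernel_sum N \<phi> = (\<Sum>k\<le>N. cis (real k * \<phi>) / of_real (sqrt (real k + 1)))"

text \<open>Comparison with the integral of x^(-1/2): consecutive square roots s < t satisfy 1 / t
  \<le> 2 (t - s).\<close>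

lemma sum_inverse_sqrt_le: "(\<Sum>k<M. 1 / sqrt (real k + 1)) \<le> 2 * sqrt (real M)"
proof (induction M)
  case (Suc M)
  define s t where "s = sqrt (real M)" and "t = sqrt (real M + 1)"
  have st: "s \<ge> 0" "t > 0" "t\<^sup>2 - s\<^sup>2 = 1"
    by (simp_all add: s_def t_def)
  have "0 \<le> (t - s)\<^sup>2" by simp
  then have "2 * t * s + 1 \<le> 2 * t\<^sup>2"
    using st(3) unfolding power2_diff by linarith
  then have "2 * s + 1 / t \<le> 2 * t"
    using st(2) by (simp add: field_simps power2_eq_square)
  with Suc show ?case
    by (simp add: s_def t_def add.commute)
qed simp

text \<open>Summation by parts: the factor \<open>1 - z\<close> leaves two boundary terms and the
  differences of \<open>c\<close>. As \<open>c\<close> decreases, the moduli of the differences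
  telescope, and the contributions of \<open>c (M+L)\<close> cancel, so the bound does not depend on
  \<open>L\<close>.\<close>

lemma norm_sum_decreasing_le:
  fixes z :: complex and c :: "nat \<Rightarrow> real"
  assumes z: "cmod z = 1" and c: "decseq c" "\<And>k. c k \<ge> 0"
  shows "cmod ((\<Sum>k=M..<M+L. of_real (c k) * z ^ k) * (1 - z)) \<le> 2 * c M"
proof -
  have eq: "(\<Sum>k=M..<M+L. of_real (c k) * z ^ k) * (1 - z)
      = of_real (c M) * z ^ M - of_real (c (M+L)) * z ^ (M+L)
        - (\<Sum>k=M..<M+L. of_real (c k - c (Suc k)) * z ^ Suc k)"
    by (induction L) (simp_all add: algebra_simps)
  have tele: "(\<Sum>k=M..<M+L. c k - c (Suc k)) = c M - c (M+L)"
    by (induction L) simp_all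
  have "cmod (\<Sum>k=M..<M+L. of_real (c k - c (Suc k)) * z ^ Suc k)
      \<le> (\<Sum>k=M..<M+L. c k - c (Suc k))"
  proof (rule sum_norm_le)
    fix k
    have "c k - c (Suc k) \<ge> 0"
      using c(1) by (simp add: decseq_Suc_iff)
    then show "cmod (of_real (c k - c (Suc k)) * z ^ Suc k) \<le> c k - c (Suc k)"
      by (simp add: norm_mult norm_power z del: of_real_diff)
  qed
  moreover have "cmod (of_real (c M) * z ^ M - of_real (c (M+L)) * z ^ (M+L)) \<le> c M + c (M+L)"
    by (rule order_trans[OF norm_triangle_ineq4]) (simp add: norm_mult norm_power z c)
  ultimately show ?thesis
    unfolding eq tele by (intro order_trans[OF norm_triangle_ineq4]) linarith
qed

text \<open>The sum is cut at \<open>M \<approx> 1 / d\<close>: absolute values below, summation by parts above.\<close>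

lemma kernel_sum_bound:
  assumes "cis \<phi> \<noteq> 1"
  shows "cmod (kernel_sum N \<phi>) \<le> 4 / cmod (1 - cis \<phi>) powr (1/2)"
proof -
  define d where "d = cmod (1 - cis \<phi>)"
  define M where "M = nat \<lfloor>1 / d\<rfloor>"
  define c where "c = (\<lambda>k. 1 / sqrt (real k + 1))"
  have d: "d > 0" using assms by (simp add: d_def)
  have M: "real M \<le> 1 / d" "1 / d \<le> real M + 1"
    using d by (simp_all add: M_def)
  have summand: "cis (real k * \<phi>) / of_real (sqrt (real k + 1)) = of_real (c k) * cis \<phi> ^ k" for k
    by (simp add: c_def Complex.DeMoivre)
  have low: "cmod (\<Sum>k<K. of_real (c k) * cis \<phi> ^ k) \<le> 2 / sqrt d" if "K \<le> M" for K
  proof -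
    have "cmod (\<Sum>k<K. of_real (c k) * cis \<phi> ^ k) \<le> (\<Sum>k<K. c k)"
      by (rule sum_norm_le) (simp add: c_def norm_mult norm_power norm_divide)
    also have "\<dots> \<le> 2 * sqrt (real K)"
      unfolding c_def by (rule sum_inverse_sqrt_le)
    also have "\<dots> \<le> 2 * sqrt (1 / d)"
      using that M(1) by simp
    finally show ?thesis by (simp add: real_sqrt_divide)
  qed
  have "cmod (\<Sum>k\<le>N. of_real (c k) * cis \<phi> ^ k) \<le> 4 / sqrt d"
  proof (cases "Suc N \<le> M")
    case True
    show ?thesis
      using low[OF True] d by (simp add: lessThan_Suc_atMost divide_right_mono order_trans)
  next
    case False
    then obtain L where L: "Suc N = M + L"
      using nat_le_iff_add nat_le_linear by blast
    let ?S = "\<Sum>k=M..<M+L. of_real (c k) * cis \<phi> ^ k"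
    have dec: "decseq c"
      by (auto simp: c_def decseq_def intro!: divide_left_mono)
    have "cmod ?S * d \<le> 2 * c M"
      using norm_sum_decreasing_le[of "cis \<phi>" c M L] dec
      by (simp add: c_def d_def norm_mult)
    \<comment> \<open>The \<open>+ 1\<close> under the root in \<open>c\<close> absorbs the rounding
      down in \<open>M\<close>.\<close>
    also have "c M \<le> sqrt d"
    proof -
      have "sqrt (1 / (real M + 1)) \<le> sqrt d"
        using M(2) d by (simp add: field_simps)
      then show ?thesis by (simp add: c_def real_sqrt_divide)
    qed
    finally have "cmod ?S \<le> 2 * sqrt d / d"
      using d by (simp add: field_simps)
    also have "\<dots> = 2 / sqrt d"
      using d by (simp add: field_simps)
    finally have high: "cmod ?S \<le> 2 / sqrt d" .
    have "(\<Sum>k\<le>N. of_real (c k) * cis \<phi> ^ k) = (\<Sum>k<M. of_real (c k) * cis \<phi> ^ k) + ?S"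
      unfolding lessThan_Suc_atMost[symmetric] L
      by (subst sum.atLeastLessThan_concat[of 0 M "M + L", symmetric, unfolded atLeast0LessThan]) auto
    then have "cmod (\<Sum>k\<le>N. of_real (c k) * cis \<phi> ^ k) \<le> 2 / sqrt d + 2 / sqrt d"
      using norm_triangle_mono[OF low[OF order_refl] high] by simp
    then show ?thesis by simp
  qed
  then show ?thesis
    using d by (simp add: kernel_sum_def summand powr_half_sqrt flip: d_def)
qed

subsection \<open>Orthogonality of characters\<close>

definition circle_measure :: "real measure"
  where "circle_measure = uniform_measure lborel {0..<2 * pi}"

text \<open>The product measure before completion. All functions integrated below are handled here,
  where product integration applies; \<open>nn_integral_completion\<close> carries nonnegative
  integrals over to \<open>torus_measure\<close>.\<close>

definition torus_borel :: "nat \<Rightarrow> (nat \<Rightarrow> real) measure"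
  where "torus_borel n = (\<Pi>\<^sub>M j\<in>{..<n}. circle_measure)"

lemma torus_measure_eq: "torus_measure n = completion (torus_borel n)"
  by (simp add: torus_measure_def torus_borel_def circle_measure_def)

lemma prob_space_circle_measure: "prob_space circle_measure"
  unfolding circle_measure_def by (rule prob_space_uniform_measure) auto

lemma prob_space_torus_borel: "prob_space (torus_borel n)"
  unfolding torus_borel_def by (intro prob_space_PiM prob_space_circle_measure)

lemma sets_circle_measure [measurable_cong]: "sets circle_measure = sets borel"
  by (simp add: circle_measure_def)

lemma measurable_cis [measurable]: "cis \<in> borel_measurable borel"
  by (intro borel_measurable_continuous_onI continuous_intros)

text \<open>The frequency is an integer because a character times a conjugate character has
  exponents of either sign. For nonzero \<open>k\<close> the antiderivative is periodic, so its
  increment vanishes.\<close>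

lemma integral_cis_circle:
  fixes k :: int
  shows "(\<integral>x. cis (of_int k * x) \<partial>circle_measure) = (if k = 0 then 1 else 0)"
proof (cases "k = 0")
  case True
  then show ?thesis
    using prob_space.prob_space[OF prob_space_circle_measure] by simp
next
  case False
  let ?F = "\<lambda>x. cis (of_int k * x) / (\<i> * of_int k)"
  have meas: "(\<lambda>x. cis (of_int k * x)) \<in> borel_measurable lborel"
    by simp
  have circ: "circle_measure = density lborel (\<lambda>x. ennreal (indicator {0..<2*pi} x / (2*pi)))"
    unfolding circle_measure_def uniform_measure_def
    by (intro density_cong) (auto simp: divide_ennreal indicator_def ennreal_1[symmetric] simp del: ennreal_1)
  have "(\<integral>x. cis (of_int k * x) \<partial>circle_measure)
     = (\<integral>x. (indicator {0..<2*pi} x / (2*pi)) *\<^sub>R cis (of_int k * x) \<partial>lborel)"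
    unfolding circ by (rule integral_density[OF meas]) auto
  \<comment> \<open>Adding the null point \<open>2 * pi\<close> closes the interval for the
    fundamental theorem of calculus.\<close>
  also have "\<dots> = (\<integral>x. (1 / (2*pi)) *\<^sub>R (indicator {0..2*pi} x *\<^sub>R cis (of_int k * x)) \<partial>lborel)"
  proof (rule integral_cong_AE)
    show "AE x in lborel. (indicator {0..<2*pi} x / (2*pi)) *\<^sub>R cis (of_int k * x)
        = (1 / (2*pi)) *\<^sub>R (indicator {0..2*pi} x *\<^sub>R cis (of_int k * x))"
      using AE_lborel_singleton[of "2*pi"] by eventually_elim (auto simp: indicator_def)
  qed simp_all
  also have "\<dots> = (1 / (2*pi)) *\<^sub>R (\<integral>x. indicator {0..2*pi} x *\<^sub>R cis (of_int k * x) \<partial>lborel)"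
    by (rule integral_scaleR_right)
  also have "(\<integral>x. indicator {0..2*pi} x *\<^sub>R cis (of_int k * x) \<partial>lborel) = ?F (2*pi) - ?F 0"
  proof (rule integral_FTC_Icc)
    fix x :: real
    have ii: "\<i> * (r * (\<i> * z)) = - (r * z)" for r z
      by (simp add: complex_eq_iff)
    have "((\<lambda>x. cis (of_int k * x)) has_derivative
        (\<lambda>t. (of_int k * t) *\<^sub>R (\<i> * cis (of_int k * x)))) (at x within {0..2*pi})"
      by (auto intro!: derivative_eq_intros)
    from bounded_linear.has_derivative[OF bounded_linear_divide[of "\<i> * of_int k"] this]
    show "(?F has_vector_derivative cis (of_int k * x)) (at x within {0..2*pi})"
      unfolding has_vector_derivative_def
      by (rule has_derivative_eq_rhs) (use False in \<open>auto simp: scaleR_conv_of_real ii\<close>)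
  qed (auto intro!: continuous_intros)
  also have "?F (2*pi) - ?F 0 = 0"
    using cis_multiple_2pi[of "of_int k"] by (simp add: mult.commute mult.left_commute)
  finally show ?thesis using False by simp
qed

definition character :: "nat \<Rightarrow> (nat \<Rightarrow> nat) \<Rightarrow> (nat \<Rightarrow> real) \<Rightarrow> complex"
  where "character n \<alpha> \<psi> = cis (\<Sum>j<n. real (\<alpha> j) * \<psi> j)"

lemma cis_sum: "cis (\<Sum>j\<in>A. f j) = (\<Prod>j\<in>A. cis (f j))"
  by (induction A rule: infinite_finite_induct) (simp_all flip: cis_mult)

lemma measurable_character [measurable]: "character n \<alpha> \<in> borel_measurable (torus_borel n)"
  unfolding character_def torus_borel_def by measurable

lemma measurable_cnj [measurable]: "cnj \<in> borel_measurable borel"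
  by (intro borel_measurable_continuous_onI continuous_intros)

lemma norm_character [simp]: "cmod (character n \<alpha> \<psi>) = 1"
  by (simp add: character_def)

lemma character_mult_cnj: "character n \<alpha> \<psi> * cnj (character n \<beta> \<psi>)
    = (\<Prod>j<n. cis (of_int (int (\<alpha> j) - int (\<beta> j)) * \<psi> j))"
  by (simp add: character_def cis_cnj cis_mult left_diff_distrib sum_subtractf flip: cis_sum)

text \<open>The integrand is a product of functions of single coordinates, so its integral over the
  product measure factors.\<close>

lemma integral_character_mult_cnj:
  assumes "\<alpha> \<in> multi_indices n" "\<beta> \<in> multi_indices n"
  shows "(\<integral>\<psi>. character n \<alpha> \<psi> * cnj (character n \<beta> \<psi>) \<partial>torus_borel n) = (if \<alpha> = \<beta> then 1 else 0)"
proof -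
  interpret c: prob_space circle_measure by (rule prob_space_circle_measure)
  interpret product_sigma_finite "\<lambda>_::nat. circle_measure" by unfold_locales
  have "(\<integral>\<psi>. character n \<alpha> \<psi> * cnj (character n \<beta> \<psi>) \<partial>torus_borel n)
     = (\<Prod>j<n. \<integral>x. cis (of_int (int (\<alpha> j) - int (\<beta> j)) * x) \<partial>circle_measure)"
    unfolding character_mult_cnj torus_borel_def
    by (intro product_integral_prod c.integrable_const_bound[where B = 1]) auto
  also have "\<dots> = (\<Prod>j<n. if \<alpha> j = \<beta> j then 1 else 0)"
    unfolding integral_cis_circle by (intro prod.cong) auto
  also have "\<dots> = (if \<forall>j<n. \<alpha> j = \<beta> j then 1 else 0)"
    by auto
  \<comment> \<open>Multi-indices are \<open>undefined\<close> outside \<open>{..<n}\<close>, so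
    agreement below \<open>n\<close> is equality.\<close>
  also have "(\<forall>j<n. \<alpha> j = \<beta> j) \<longleftrightarrow> \<alpha> = \<beta>"
    using assms unfolding multi_indices_def by (auto intro: PiE_ext)
  finally show ?thesis .
qed

text \<open>Serves in two roles: with coefficients \<open>a\<close> it is a piece of the series at
  one point, with weighted coefficients a square integrable function on the torus.\<close>

definition trig_poly ::
    "nat \<Rightarrow> (nat \<Rightarrow> nat) set \<Rightarrow> ((nat \<Rightarrow> nat) \<Rightarrow> 'h) \<Rightarrow> (nat \<Rightarrow> real) \<Rightarrow> 'h::complex_hilbert_space"
  where "trig_poly n A b \<psi> = (\<Sum>\<alpha>\<in>A. character n \<alpha> \<psi> *\<^sub>C b \<alpha>)"

lemma norm_trig_poly_sq:
  "complex_of_real ((norm (trig_poly n A b \<psi>))\<^sup>2) =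
    (\<Sum>\<alpha>\<in>A. \<Sum>\<beta>\<in>A. character n \<alpha> \<psi> * cnj (character n \<beta> \<psi>) * cinner (b \<alpha>) (b \<beta>))"
  unfolding cinner_self[symmetric] trig_poly_def cinner_sum_left cinner_sum_right
    cinner_scaleC_left cinner_scaleC_right
    sum_distrib_left
  by (subst sum.swap) (simp add: mult_ac)

text \<open>The norm is the square root of a finite sum of scalar functions, so measurability in the
  possibly non-separable Hilbert space is never at issue.\<close>

lemma measurable_norm_trig_poly [measurable]:
  "(\<lambda>\<psi>. norm (trig_poly n A b \<psi>)) \<in> borel_measurable (torus_borel n)"
proof -
  have "(\<lambda>\<psi>. sqrt (Re (\<Sum>\<alpha>\<in>A. \<Sum>\<beta>\<in>A. character n \<alpha> \<psi> * cnj (character n \<beta> \<psi>) * cinner (b \<alpha>) (b \<beta>))))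
      \<in> borel_measurable (torus_borel n)"
    by (intro measurable_compose[OF _ borel_measurable_sqrt] measurable_compose[OF _ borel_measurable_Re]
        borel_measurable_sum borel_measurable_times measurable_const measurable_character
        measurable_compose[OF measurable_character measurable_cnj]) simp
  then show ?thesis
    unfolding norm_trig_poly_sq[symmetric] by simp
qed

lemma integrable_character_mult_cnj:
  "integrable (torus_borel n) (\<lambda>\<psi>. character n \<alpha> \<psi> * cnj (character n \<beta> \<psi>))"
proof -
  interpret prob_space "torus_borel n" by (rule prob_space_torus_borel)
  show ?thesis
    by (rule integrable_const_bound[where B = 1]) (auto simp: norm_mult)
qed

text \<open>Parseval's identity for finite sums: orthonormality of the characters keeps only the
  diagonal of the expanded square.\<close>

lemma nn_integral_norm_trig_poly_sq:
  assumes A: "finite A" "A \<subseteq> multi_indices n"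
  shows "(\<integral>\<^sup>+\<psi>. ennreal ((norm (trig_poly n A b \<psi>))\<^sup>2) \<partial>torus_borel n)
    = ennreal (\<Sum>\<alpha>\<in>A. (norm (b \<alpha>))\<^sup>2)"
proof -
  have int: "integrable (torus_borel n) (\<lambda>\<psi>. complex_of_real ((norm (trig_poly n A b \<psi>))\<^sup>2))"
    unfolding norm_trig_poly_sq
    by (intro Bochner_Integration.integrable_sum integrable_mult_left integrable_character_mult_cnj)
  have "(\<integral>\<psi>. complex_of_real ((norm (trig_poly n A b \<psi>))\<^sup>2) \<partial>torus_borel n)
      = (\<Sum>\<alpha>\<in>A. \<Sum>\<beta>\<in>A. (\<integral>\<psi>. character n \<alpha> \<psi> * cnj (character n \<beta> \<psi>) \<partial>torus_borel n) * cinner (b \<alpha>) (b \<beta>))"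
    unfolding norm_trig_poly_sq
    by (simp add: Bochner_Integration.integral_sum integrable_character_mult_cnj)
  also have "\<dots> = (\<Sum>\<alpha>\<in>A. \<Sum>\<beta>\<in>A. (if \<alpha> = \<beta> then 1 else 0) * cinner (b \<alpha>) (b \<beta>))"
    using A(2) by (intro sum.cong refl) (auto simp: integral_character_mult_cnj subset_iff)
  also have "\<dots> = (\<Sum>\<alpha>\<in>A. cinner (b \<alpha>) (b \<alpha>))"
    using A(1) by (intro sum.cong refl) (simp add: if_distrib[of "\<lambda>x. x * _"] cong: if_cong)
  finally have "(\<integral>\<psi>. complex_of_real ((norm (trig_poly n A b \<psi>))\<^sup>2) \<partial>torus_borel n)
      = complex_of_real (\<Sum>\<alpha>\<in>A. (norm (b \<alpha>))\<^sup>2)"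
    by (simp add: cinner_self)
  then have "complex_of_real (\<integral>\<psi>. (norm (trig_poly n A b \<psi>))\<^sup>2 \<partial>torus_borel n)
      = complex_of_real (\<Sum>\<alpha>\<in>A. (norm (b \<alpha>))\<^sup>2)"
    by (simp only: integral_complex_of_real)
  then have "(\<integral>\<psi>. (norm (trig_poly n A b \<psi>))\<^sup>2 \<partial>torus_borel n) = (\<Sum>\<alpha>\<in>A. (norm (b \<alpha>))\<^sup>2)"
    using of_real_eq_iff by blast
  moreover have "integrable (torus_borel n) (\<lambda>\<psi>. (norm (trig_poly n A b \<psi>))\<^sup>2)"
    using integrable_Re[OF int] by simp
  ultimately show ?thesis
    by (subst nn_integral_eq_integral) auto
qed

subsection \<open>Domination of partial sums by potentials\<close>

definition index_box :: "nat \<Rightarrow> (nat \<Rightarrow> nat) \<Rightarrow> (nat \<Rightarrow> nat) set"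
  where "index_box n N = (\<Pi>\<^sub>E j\<in>{..<n}. {..N j})"

definition dirichlet_weight :: "nat \<Rightarrow> (nat \<Rightarrow> nat) \<Rightarrow> real"
  where "dirichlet_weight n \<alpha> = (\<Prod>j<n. real (\<alpha> j + 1))"

lemma dirichlet_weight_pos: "dirichlet_weight n \<alpha> > 0"
  unfolding dirichlet_weight_def by (intro prod_pos) auto

lemma sqrt_prod: "sqrt (prod f A) = (\<Prod>i\<in>A. sqrt (f i))"
  by (induction A rule: infinite_finite_induct) (simp_all add: real_sqrt_mult)

text \<open>Exhibits the product as a convolution kernel: integrated in \<psi> against a character
  with index in the box, it returns that character at \<theta> divided by the square root of the
  weight; other multi-indices give 0.\<close>

lemma prod_kernel_sum:
  "(\<Prod>j<n. kernel_sum (N j) (\<theta> j - \<psi> j)) =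
    (\<Sum>\<beta>\<in>index_box n N. character n \<beta> \<theta> * cnj (character n \<beta> \<psi>) / of_real (sqrt (dirichlet_weight n \<beta>)))"
proof -
  have "(\<Prod>j<n. kernel_sum (N j) (\<theta> j - \<psi> j)) =
      (\<Sum>\<beta>\<in>index_box n N. \<Prod>j<n. cis (real (\<beta> j) * (\<theta> j - \<psi> j)) / of_real (sqrt (real (\<beta> j) + 1)))"
    unfolding kernel_sum_def index_box_def by (rule prod_sum_PiE) auto
  then show ?thesis
    by (simp add: prod_dividef sqrt_prod dirichlet_weight_def character_def cis_cnj cis_mult
        right_diff_distrib sum_subtractf add.commute flip: cis_sum)
qed

text \<open>Distances on the circle are invariant under rotation, so off the diagonal this is
  \<open>kernel_sum_bound\<close> at \<open>s - t\<close>.\<close>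

lemma ennreal_kernel_sum_le:
  "ennreal (cmod (kernel_sum N (s - t)))
    \<le> ennreal 4 * (1 / ennreal (cmod (cis s - cis t) powr (1 / 2)))"
proof (cases "cis s = cis t")
  case True
  \<comment> \<open>The right-hand side is \<infinity> here, because 1 / 0 = \<infinity> in
    \<open>ennreal\<close>.\<close>
  then show ?thesis by (simp add: ennreal_mult_top)
next
  case False
  then have ne: "cis (s - t) \<noteq> 1"
    by (auto simp flip: cis_divide)
  have "cis s - cis t = - (cis t * (1 - cis (s - t)))"
    by (simp add: algebra_simps cis_mult)
  then have "cmod (cis s - cis t) = cmod (1 - cis (s - t))"
    by (simp add: norm_mult)
  with kernel_sum_bound[OF ne, of N] have "cmod (kernel_sum N (s - t)) \<le> 4 * (1 / cmod (cis s - cis t) powr (1/2))"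
    by simp
  then have "ennreal (cmod (kernel_sum N (s - t))) \<le> ennreal (4 * (1 / cmod (cis s - cis t) powr (1/2)))"
    by (rule ennreal_leI)
  also have "\<dots> = ennreal 4 * (ennreal 1 / ennreal (cmod (cis s - cis t) powr (1/2)))"
    using False by (subst ennreal_mult) (auto simp: divide_ennreal simp del: ennreal_1)
  finally show ?thesis by simp
qed

lemma finite_index_box: "finite (index_box n N)"
  by (simp add: index_box_def finite_PiE)

lemma index_box_subset: "index_box n N \<subseteq> multi_indices n"
  by (auto simp: index_box_def multi_indices_def)

lemma sum_delta_mult:
  fixes f :: "'a \<Rightarrow> 'b::semiring_1"
  assumes "finite A"
  shows "(\<Sum>x\<in>A. (if x = y then 1 else 0) * f x) = (if y \<in> A then f y else 0)"
  using assms by (simp add: if_distrib[of "\<lambda>c. c * _"] cong: if_cong)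

definition riesz_kernel :: "nat \<Rightarrow> (nat \<Rightarrow> real) \<Rightarrow> (nat \<Rightarrow> real) \<Rightarrow> ennreal"
  where "riesz_kernel n \<theta> \<psi> = (\<Prod>j<n. 1 / ennreal (cmod (cis (\<theta> j) - cis (\<psi> j)) powr (1 / 2)))"

lemma measurable_riesz_kernel [measurable]: "riesz_kernel n \<theta> \<in> borel_measurable (torus_borel n)"
  unfolding riesz_kernel_def torus_borel_def divide_ennreal_def by measurable

lemma potential_eq: "potential n g \<theta> = (\<integral>\<^sup>+\<psi>. riesz_kernel n \<theta> \<psi> * g \<psi> \<partial>torus_borel n)"
  by (simp add: potential_def riesz_kernel_def torus_measure_eq nn_integral_completion)

text \<open>By duality it suffices to pair with the vector \<open>h\<close> itself; this avoids vector-valued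
  integrals, which would require a separable space.\<close>

lemma norm_trig_poly_index_box_le_potential:
  fixes a :: "(nat \<Rightarrow> nat) \<Rightarrow> 'h::complex_hilbert_space"
  assumes A: "finite A" "A \<subseteq> multi_indices n"
  shows "ennreal (norm (trig_poly n (A \<inter> index_box n N) a \<theta>))
    \<le> ennreal (4 ^ n) * potential n (\<lambda>\<psi>. ennreal (norm (trig_poly n A (\<lambda>\<alpha>. sqrt (dirichlet_weight n \<alpha>) *\<^sub>R a \<alpha>) \<psi>))) \<theta>"
proof -
  define b where "b = (\<lambda>\<alpha>. sqrt (dirichlet_weight n \<alpha>) *\<^sub>R a \<alpha>)"
  define h where "h = trig_poly n (A \<inter> index_box n N) a \<theta>"
  define K where "K \<psi> = (\<Prod>j<n. kernel_sum (N j) (\<theta> j - \<psi> j))" for \<psi>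
  let ?P = "torus_borel n"
  let ?w = "\<lambda>\<beta>. complex_of_real (sqrt (dirichlet_weight n \<beta>))"
  have expand: "K \<psi> * cinner (trig_poly n A b \<psi>) h
      = (\<Sum>\<beta>\<in>index_box n N. \<Sum>\<alpha>\<in>A. (character n \<alpha> \<psi> * cnj (character n \<beta> \<psi>))
          * (character n \<beta> \<theta> / ?w \<beta> * cinner (b \<alpha>) h))" for \<psi>
    unfolding K_def prod_kernel_sum trig_poly_def cinner_sum_left cinner_scaleC_left
      sum_distrib_left sum_distrib_right
    by (subst sum.swap) (simp add: mult_ac)
  have int: "integrable ?P (\<lambda>\<psi>. K \<psi> * cinner (trig_poly n A b \<psi>) h)"
    unfolding expand
    by (intro Bochner_Integration.integrable_sum integrable_mult_left integrable_character_mult_cnj)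
  have "(\<integral>\<psi>. K \<psi> * cinner (trig_poly n A b \<psi>) h \<partial>?P)
      = (\<Sum>\<beta>\<in>index_box n N. \<Sum>\<alpha>\<in>A. (\<integral>\<psi>. character n \<alpha> \<psi> * cnj (character n \<beta> \<psi>) \<partial>?P)
          * (character n \<beta> \<theta> / ?w \<beta> * cinner (b \<alpha>) h))"
    unfolding expand
    by (simp add: Bochner_Integration.integral_sum integrable_character_mult_cnj)
  \<comment> \<open>Orthogonality collapses the double sum to the frequencies common to the kernel
    and the polynomial, that is to \<open>A \<inter> index_box n N\<close>.\<close>
  also have "\<dots> = (\<Sum>\<beta>\<in>index_box n N. \<Sum>\<alpha>\<in>A. (if \<alpha> = \<beta> then 1 else 0)
          * (character n \<beta> \<theta> / ?w \<beta> * cinner (b \<alpha>) h))"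
    using A(2) index_box_subset[of n N]
    by (intro sum.cong refl) (auto simp: integral_character_mult_cnj subset_iff)
  also have "\<dots> = (\<Sum>\<beta>\<in>index_box n N. if \<beta> \<in> A then character n \<beta> \<theta> / ?w \<beta> * cinner (b \<beta>) h else 0)"
    by (intro sum.cong refl sum_delta_mult A(1))
  also have "\<dots> = (\<Sum>\<beta>\<in>A \<inter> index_box n N. character n \<beta> \<theta> / ?w \<beta> * cinner (b \<beta>) h)"
    by (subst sum.inter_restrict[OF finite_index_box, symmetric]) (simp add: Int_commute)
  \<comment> \<open>The square root of the weight inside \<open>b\<close> cancels the denominator
    coming from the kernel.\<close>
  also have "\<dots> = (\<Sum>\<beta>\<in>A \<inter> index_box n N. character n \<beta> \<theta> * cinner (a \<beta>) h)"
  proof (rule sum.cong[OF refl])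
    fix \<beta>
    show "character n \<beta> \<theta> / ?w \<beta> * cinner (b \<beta>) h = character n \<beta> \<theta> * cinner (a \<beta>) h"
      using dirichlet_weight_pos[of n \<beta>] by (simp add: b_def cinner_scaleR_left)
  qed
  also have "\<dots> = cinner h h"
    by (subst (2) h_def) (simp add: trig_poly_def cinner_sum_left cinner_scaleC_left)
  finally have pair: "(\<integral>\<psi>. K \<psi> * cinner (trig_poly n A b \<psi>) h \<partial>?P) = of_real ((norm h)\<^sup>2)"
    by (simp add: cinner_self)
  have "ennreal ((norm h)\<^sup>2) = ennreal (cmod (\<integral>\<psi>. K \<psi> * cinner (trig_poly n A b \<psi>) h \<partial>?P))"
    by (simp add: pair norm_power)
  also have "\<dots> \<le> (\<integral>\<^sup>+\<psi>. ennreal (cmod (K \<psi> * cinner (trig_poly n A b \<psi>) h)) \<partial>?P)"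
    by (rule integral_norm_bound_ennreal[OF int])
  also have "\<dots> \<le> (\<integral>\<^sup>+\<psi>. (ennreal (4 ^ n) * ennreal (norm h))
      * (riesz_kernel n \<theta> \<psi> * ennreal (norm (trig_poly n A b \<psi>))) \<partial>?P)"
  proof (rule nn_integral_mono)
    fix \<psi>
    have "ennreal (cmod (K \<psi>)) \<le> ennreal (4 ^ n) * riesz_kernel n \<theta> \<psi>"
    proof -
      have "ennreal (cmod (K \<psi>)) = (\<Prod>j<n. ennreal (cmod (kernel_sum (N j) (\<theta> j - \<psi> j))))"
        by (simp add: K_def prod_norm prod_ennreal)
      also have "\<dots> \<le> (\<Prod>j<n. ennreal 4 * (1 / ennreal (cmod (cis (\<theta> j) - cis (\<psi> j)) powr (1 / 2))))"
        by (rule prod_mono_ennreal) (rule ennreal_kernel_sum_le)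
      also have "\<dots> = ennreal (4 ^ n) * riesz_kernel n \<theta> \<psi>"
        by (simp add: riesz_kernel_def prod.distrib ennreal_power del: ennreal_numeral)
      finally show ?thesis .
    qed
    moreover have "ennreal (cmod (cinner (trig_poly n A b \<psi>) h))
        \<le> ennreal (norm (trig_poly n A b \<psi>)) * ennreal (norm h)"
      by (simp add: cinner_Cauchy_Schwarz flip: ennreal_mult)
    ultimately have "ennreal (cmod (K \<psi>)) * ennreal (cmod (cinner (trig_poly n A b \<psi>) h))
        \<le> (ennreal (4 ^ n) * riesz_kernel n \<theta> \<psi>) * (ennreal (norm (trig_poly n A b \<psi>)) * ennreal (norm h))"
      by (rule mult_mono) auto
    then show "ennreal (cmod (K \<psi> * cinner (trig_poly n A b \<psi>) h)) \<le> (ennreal (4 ^ n) * ennreal (norm h))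
        * (riesz_kernel n \<theta> \<psi> * ennreal (norm (trig_poly n A b \<psi>)))"
      by (simp add: norm_mult ennreal_mult mult_ac)
  qed
  also have "\<dots> = (ennreal (4 ^ n) * ennreal (norm h))
      * (\<integral>\<^sup>+\<psi>. riesz_kernel n \<theta> \<psi> * ennreal (norm (trig_poly n A b \<psi>)) \<partial>?P)"
    by (rule nn_integral_cmult) measurable
  also have "(\<integral>\<^sup>+\<psi>. riesz_kernel n \<theta> \<psi> * ennreal (norm (trig_poly n A b \<psi>)) \<partial>?P)
      = potential n (\<lambda>\<psi>. ennreal (norm (trig_poly n A b \<psi>))) \<theta>"
    by (simp add: potential_eq)
  finally have main: "ennreal ((norm h)\<^sup>2) \<le> (ennreal (4 ^ n) * ennreal (norm h))
      * potential n (\<lambda>\<psi>. ennreal (norm (trig_poly n A b \<psi>))) \<theta>" .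
  \<comment> \<open>The estimate has one factor \<open>norm h\<close> on the right and two on the
    left; dividing it out requires \<open>h\<close> to be nonzero.\<close>
  show ?thesis
  proof (cases "h = 0")
    case True
    then show ?thesis by (simp add: h_def)
  next
    case False
    then have h: "ennreal (norm h) \<noteq> 0" "ennreal (norm h) \<noteq> top"
      by auto
    have "ennreal (norm h) * ennreal (norm h) \<le> ennreal (norm h) *
        (ennreal (4 ^ n) * potential n (\<lambda>\<psi>. ennreal (norm (trig_poly n A b \<psi>))) \<theta>)"
      using main by (simp add: power2_eq_square ennreal_mult mult_ac)
    then have "ennreal (norm h) \<le> ennreal (4 ^ n) * potential n (\<lambda>\<psi>. ennreal (norm (trig_poly n A b \<psi>))) \<theta>"
      using h by (simp add: ennreal_mult_le_mult_iff)
    then show ?thesis by (simp add: h_def b_def)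
  qed
qed

lemma potential_cmult:
  assumes "w \<in> borel_measurable (torus_borel n)"
  shows "potential n (\<lambda>\<psi>. c * w \<psi>) \<theta> = c * potential n w \<theta>"
  unfolding potential_eq using assms
  by (subst nn_integral_cmult[symmetric]) (simp_all add: mult_ac)

lemma potential_suminf:
  assumes [measurable]: "\<And>m::nat. g m \<in> borel_measurable (torus_borel n)"
  shows "potential n (\<lambda>\<psi>. \<Sum>m. g m \<psi>) \<theta> = (\<Sum>m. potential n (g m) \<theta>)"
  unfolding potential_eq by (subst nn_integral_suminf[symmetric]) simp_all

subsection \<open>Exceptional sets\<close>

text \<open>Every positive multiple of \<open>w\<close> is admissible, since its potential is still
  infinite on \<open>E\<close>, and its squared norm can be made as small as desired.\<close>

lemma capacity_eq_0_if_potential_top: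
  assumes w: "w \<in> borel_measurable (torus_borel n)"
    and fin: "(\<integral>\<^sup>+\<psi>. (w \<psi>)\<^sup>2 \<partial>torus_borel n) < \<infinity>"
    and top: "\<And>\<theta>. \<theta> \<in> E \<Longrightarrow> potential n w \<theta> = \<infinity>"
  shows "capacity n E = 0"
proof -
  obtain r where r: "(\<integral>\<^sup>+\<psi>. (w \<psi>)\<^sup>2 \<partial>torus_borel n) = ennreal r" "r \<ge> 0"
    using fin by (auto simp: less_top_ennreal)
  have le: "capacity n E \<le> ennreal (\<epsilon>\<^sup>2 * r)" if "\<epsilon> > 0" for \<epsilon>
  proof -
    let ?g = "\<lambda>\<psi>. ennreal \<epsilon> * w \<psi>"
    have "capacity n E \<le> (\<integral>\<^sup>+\<psi>. (?g \<psi>)\<^sup>2 \<partial>torus_measure n)"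
      unfolding capacity_def
    proof (rule Inf_lower, rule CollectI, intro exI conjI refl ballI)
      show "?g \<in> borel_measurable (torus_measure n)"
        unfolding torus_measure_eq using w by (intro measurable_completion) measurable
      show "1 \<le> potential n ?g \<theta>" if "\<theta> \<in> E" for \<theta>
        using top[OF that] \<open>\<epsilon> > 0\<close> by (simp add: potential_cmult[OF w] ennreal_mult_top)
    qed simp
    also have "\<dots> = (\<integral>\<^sup>+\<psi>. ennreal (\<epsilon>\<^sup>2) * (w \<psi>)\<^sup>2 \<partial>torus_borel n)"
      using that by (simp add: torus_measure_eq nn_integral_completion power_mult_distrib ennreal_power)
    also have "\<dots> = ennreal (\<epsilon>\<^sup>2 * r)"
      using w r by (subst nn_integral_cmult) (auto simp: ennreal_mult)
    finally show ?thesis .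
  qed
  have "capacity n E \<le> 0"
  proof (rule ennreal_le_epsilon)
    fix e :: real
    assume e: "e > 0"
    \<comment> \<open>Dividing by \<open>r + 1\<close> rather than \<open>r\<close> covers
      \<open>r = 0\<close>, and r / (r + 1) \<le> 1 gives the bound by \<open>e\<close>.\<close>
    have "capacity n E \<le> ennreal ((sqrt (e / (r + 1)))\<^sup>2 * r)"
      using e r(2) by (intro le) simp
    also have "\<dots> \<le> ennreal e"
      using e r(2) by (intro ennreal_leI) (simp add: field_simps)
    finally show "capacity n E \<le> 0 + ennreal e" by simp
  qed
  then show ?thesis by simp
qed

text \<open>Cauchy-Schwarz with weights \<open>2 ^ m\<close>, whose reciprocals sum to 2. It makes
  the square of a series integrable term by term.\<close>

lemma suminf_ennreal_sq_le:
  assumes x: "\<And>m. x m \<ge> 0"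
  shows "(\<Sum>m. ennreal (x m))\<^sup>2 \<le> 2 * (\<Sum>m. ennreal (2 ^ m * (x m)\<^sup>2))"
proof -
  let ?c = "2 * (\<Sum>m. ennreal (2 ^ m * (x m)\<^sup>2))"
  have fin: "(\<Sum>m<k. ennreal (x m)) * (\<Sum>m<k. ennreal (x m)) \<le> ?c" for k
  proof -
    have sq: "((1 / sqrt 2) ^ m)\<^sup>2 = (1 / 2 :: real) ^ m" "(sqrt 2 ^ m)\<^sup>2 = (2 :: real) ^ m" for m
      by (simp_all add: power2_eq_square flip: power_mult_distrib)
    have "(\<Sum>m<k. x m)\<^sup>2 = (\<Sum>m<k. (1 / sqrt 2) ^ m * (sqrt 2 ^ m * x m))\<^sup>2"
      by (simp add: power_divide)
    also have "\<dots> \<le> (\<Sum>m<k. ((1 / sqrt 2) ^ m)\<^sup>2) * (\<Sum>m<k. (sqrt 2 ^ m * x m)\<^sup>2)"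
      by (rule Cauchy_Schwarz_ineq_sum)
    also have "\<dots> = (\<Sum>m<k. (1 / 2) ^ m) * (\<Sum>m<k. 2 ^ m * (x m)\<^sup>2)"
      by (simp only: sq power_mult_distrib)
    also have "\<dots> \<le> 2 * (\<Sum>m<k. 2 ^ m * (x m)\<^sup>2)"
    proof -
      have "(\<Sum>m<k. (1 / 2 :: real) ^ m) = 2 - 2 * (1 / 2) ^ k"
        by (induction k) auto
      then show ?thesis
        by (intro mult_right_mono sum_nonneg) simp_all
    qed
    finally have "ennreal ((\<Sum>m<k. x m)\<^sup>2) \<le> ennreal (2 * (\<Sum>m<k. 2 ^ m * (x m)\<^sup>2))"
      by (rule ennreal_leI)
    also have "\<dots> = 2 * (\<Sum>m<k. ennreal (2 ^ m * (x m)\<^sup>2))"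
      by (subst sum_ennreal) (auto simp: ennreal_mult sum_nonneg)
    also have "\<dots> \<le> ?c"
      by (intro mult_left_mono sum_le_suminf) auto
    finally show ?thesis
      using x by (simp add: sum_ennreal power2_eq_square ennreal_mult sum_nonneg)
  qed
  \<comment> \<open>The square of the series is a supremum over two independent cutoffs; enlarging
    both to their maximum reduces to \<open>fin\<close>.\<close>
  have "(\<Sum>m<i. ennreal (x m)) * (\<Sum>m<k. ennreal (x m)) \<le> ?c" for i k
  proof -
    have "(\<Sum>m<i. ennreal (x m)) * (\<Sum>m<k. ennreal (x m))
        \<le> (\<Sum>m<max i k. ennreal (x m)) * (\<Sum>m<max i k. ennreal (x m))"
      by (intro mult_mono sum_mono2) auto
    then show ?thesis using fin order_trans by blast
  qed
  then show ?thesis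
    unfolding power2_eq_square suminf_eq_SUP
    by (auto simp: SUP_mult_left_ennreal SUP_mult_right_ennreal intro!: SUP_least)
qed

text \<open>Decay like (1/4)^m pays for the factor \<open>2 ^ m\<close> from
  \<open>suminf_ennreal_sq_le\<close> and leaves a convergent geometric series.\<close>

lemma nn_integral_suminf_sq_finite:
  fixes p :: "nat \<Rightarrow> 'a \<Rightarrow> real"
  assumes [measurable]: "\<And>m. p m \<in> borel_measurable M"
    and p: "\<And>m x. p m x \<ge> 0"
    and bound: "\<And>m. (\<integral>\<^sup>+x. ennreal ((p m x)\<^sup>2) \<partial>M) \<le> ennreal (C * (1 / 4) ^ m)"
    and C: "C \<ge> 0"
  shows "(\<integral>\<^sup>+x. (\<Sum>m. ennreal (p m x))\<^sup>2 \<partial>M) < \<infinity>"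
proof -
  have "(\<integral>\<^sup>+x. (\<Sum>m. ennreal (p m x))\<^sup>2 \<partial>M)
      \<le> (\<integral>\<^sup>+x. 2 * (\<Sum>m. ennreal (2 ^ m * (p m x)\<^sup>2)) \<partial>M)"
    by (intro nn_integral_mono suminf_ennreal_sq_le p)
  also have "\<dots> = 2 * (\<Sum>m. \<integral>\<^sup>+x. ennreal (2 ^ m * (p m x)\<^sup>2) \<partial>M)"
    by (simp add: nn_integral_cmult nn_integral_suminf)
  also have "\<dots> \<le> 2 * (\<Sum>m. ennreal (C * (1 / 2) ^ m))"
  proof (intro mult_left_mono suminf_le summableI)
    fix m
    have "(\<integral>\<^sup>+x. ennreal (2 ^ m * (p m x)\<^sup>2) \<partial>M) = ennreal (2 ^ m) * (\<integral>\<^sup>+x. ennreal ((p m x)\<^sup>2) \<partial>M)"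
      by (subst nn_integral_cmult[symmetric]) (auto simp: ennreal_mult)
    also have "\<dots> \<le> ennreal (2 ^ m) * ennreal (C * (1 / 4) ^ m)"
      by (intro mult_left_mono bound) simp
    also have "\<dots> = ennreal (C * (1 / 2) ^ m)"
    proof -
      have "(2::real) ^ m * (1 / 4) ^ m = (1 / 2) ^ m"
        by (simp flip: power_mult_distrib)
      then show ?thesis
        using C by (simp add: mult.left_commute flip: ennreal_mult)
    qed
    finally show "(\<integral>\<^sup>+x. ennreal (2 ^ m * (p m x)\<^sup>2) \<partial>M) \<le> ennreal (C * (1 / 2) ^ m)" .
  qed simp
  also have "(\<Sum>m. ennreal (C * (1 / 2) ^ m)) = ennreal (\<Sum>m. C * (1 / 2) ^ m)"
    using C by (intro suminf_ennreal2 summable_mult summable_geometric) auto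
  also have "2 * \<dots> < \<infinity>"
    by (simp add: ennreal_mult_less_top)
  finally show ?thesis .
qed

subsection \<open>Convergence from summable blocks\<close>

text \<open>The strict bound, unlike the one in \<open>index_box\<close>, makes the cube of side 0
  empty when n \<ge> 1, so the blocks can start from nothing.\<close>

definition index_cube :: "nat \<Rightarrow> nat \<Rightarrow> (nat \<Rightarrow> nat) set"
  where "index_cube n M = (\<Pi>\<^sub>E j\<in>{..<n}. {..<M})"

lemma finite_index_cube: "finite (index_cube n M)"
  by (simp add: index_cube_def finite_PiE)

lemma index_cube_subset: "index_cube n M \<subseteq> multi_indices n"
  by (auto simp: index_cube_def multi_indices_def)

lemma index_cube_mono: "M \<le> M' \<Longrightarrow> index_cube n M \<subseteq> index_cube n M'"
  unfolding index_cube_def by (intro PiE_mono) auto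

text \<open>The side can be taken beyond any \<open>K\<close>, which later makes the chosen sides
  strictly increasing.\<close>

lemma finite_subset_index_cube:
  assumes "finite F" "F \<subseteq> multi_indices n"
  shows "\<exists>M>K. F \<subseteq> index_cube n M"
proof -
  have "finite (\<Union>\<alpha>\<in>F. \<alpha> ` {..<n})"
    using assms(1) by auto
  then obtain k where k: "\<forall>i\<in>(\<Union>\<alpha>\<in>F. \<alpha> ` {..<n}). i < k"
    using finite_nat_set_iff_bounded by blast
  have "F \<subseteq> index_cube n (max k (Suc K))"
  proof
    fix \<alpha>
    assume "\<alpha> \<in> F"
    then have "\<alpha> \<in> extensional {..<n}" "\<And>j. j < n \<Longrightarrow> \<alpha> j < k"
      using assms(2) k by (auto simp: multi_indices_def PiE_def)
    then show "\<alpha> \<in> index_cube n (max k (Suc K))"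
      by (auto simp: index_cube_def PiE_iff less_max_iff_disj)
  qed
  then show ?thesis
    by (intro exI[of _ "max k (Suc K)"]) auto
qed

text \<open>A finite set \<open>F\<close> already carries the whole sum up to \<open>e\<close>. A
  set \<open>A\<close> outside a cube containing \<open>F\<close> is disjoint from \<open>F\<close>,
  so it can add at most \<open>e\<close>.\<close>

lemma summable_on_multi_indices_tail:
  fixes f :: "(nat \<Rightarrow> nat) \<Rightarrow> real"
  assumes f: "f summable_on multi_indices n" "\<And>\<alpha>. f \<alpha> \<ge> 0" and e: "e > 0"
  shows "\<exists>M>K. \<forall>A. finite A \<longrightarrow> A \<subseteq> multi_indices n - index_cube n M \<longrightarrow> sum f A \<le> e"
proof -
  obtain F where F: "finite F" "F \<subseteq> multi_indices n" "dist (sum f F) (infsum f (multi_indices n)) \<le> e"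
    using infsum_finite_approximation[OF f(1) e] by blast
  obtain M where M: "M > K" "F \<subseteq> index_cube n M"
    using finite_subset_index_cube[OF F(1,2)] by blast
  have "sum f A \<le> e" if A: "finite A" "A \<subseteq> multi_indices n - index_cube n M" for A
  proof -
    have "sum f F + sum f A = sum f (F \<union> A)"
      using A M(2) F(1) by (subst sum.union_disjoint) auto
    also have "\<dots> \<le> infsum f (multi_indices n)"
      using A F f by (intro finite_sum_le_infsum) auto
    finally show ?thesis
      using F(3) by (simp add: dist_real_def)
  qed
  with M(1) show ?thesis by blast
qed

lemma eventually_pringsheim_at_top:
  "eventually (\<lambda>N. N \<in> multi_indices n \<and> (\<forall>j<n. K \<le> N j)) (pringsheim_at_top n)"
  unfolding pringsheim_at_top_def eventually_inf_principal eventually_filtercomap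
proof (intro exI conjI allI impI)
  show "eventually (\<lambda>k. K \<le> k) at_top"
    by (rule eventually_ge_at_top)
  fix N j
  assume "K \<le> (MIN j\<in>{..<n}. N j)" "j < n"
  then show "K \<le> N j"
    by (meson Min_le finite_imageI finite_lessThan image_eqI lessThan_iff order_trans)
qed

lemma rect_partial_sum_eq: "rect_partial_sum n a \<theta> N = trig_poly n (index_box n N) a \<theta>"
  by (simp add: rect_partial_sum_def trig_poly_def index_box_def character_def)

text \<open>A Weierstrass test over blocks: \<open>u m\<close> bounds block \<open>m\<close> however
  a box truncates it, so tails are small uniformly in \<open>N\<close>, while each early block is
  complete once \<open>N\<close> is large.\<close>

lemma pringsheim_convergent_if_blocks_summable:
  fixes a :: "(nat \<Rightarrow> nat) \<Rightarrow> 'h::complex_hilbert_space" and M :: "nat \<Rightarrow> nat"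
  assumes n: "n \<ge> 1" and M: "M 0 = 0" "strict_mono M"
    and u: "summable u"
    and le: "\<And>m N. norm (trig_poly n ((index_cube n (M (Suc m)) - index_cube n (M m)) \<inter> index_box n N) a \<theta>) \<le> u m"
  shows "pringsheim_convergent n a \<theta>"
proof -
  define A where "A m = index_cube n (M (Suc m)) - index_cube n (M m)" for m
  define T where "T m N = trig_poly n (A m \<inter> index_box n N) a \<theta>" for m N
  define t where "t m = trig_poly n (A m) a \<theta>" for m
  have T_le: "norm (T m N) \<le> u m" for m N
    using le by (simp add: T_def A_def)
  have u0: "u m \<ge> 0" for m
    using T_le norm_ge_zero order_trans by blast
  have T_eq: "T m N = t m" if "\<And>j. j < n \<Longrightarrow> M (Suc m) \<le> N j" for m N
  proof -
    have "A m \<subseteq> index_box n N"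
      using that by (force simp: A_def index_cube_def index_box_def PiE_iff)
    then show ?thesis
      by (simp add: T_def t_def Int_absorb2)
  qed
  \<comment> \<open>A box with all sides \<open>M (Suc m)\<close> contains block \<open>m\<close>,
    so the bound for truncated blocks applies to the full block.\<close>
  have t_le: "norm (t m) \<le> u m" for m
    using T_le[of m "\<lambda>_. M (Suc m)"] T_eq[of m "\<lambda>_. M (Suc m)"] by simp
  have t: "summable t"
    by (rule summable_comparison_test'[OF u]) (rule t_le)
  have sum_T: "trig_poly n (index_cube n (M k) \<inter> index_box n N) a \<theta> = (\<Sum>m<k. T m N)" for k N
  proof (induction k)
    case 0
    have "index_cube n 0 = {}"
      using n by (auto simp: index_cube_def PiE_eq_empty_iff intro!: exI[of _ 0])
    then show ?case by (simp add: M trig_poly_def)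
  next
    case (Suc k)
    have "index_cube n (M k) \<subseteq> index_cube n (M (Suc k))"
      using M(2) by (intro index_cube_mono) (simp add: strict_mono_less_eq)
    then have "index_cube n (M (Suc k)) \<inter> index_box n N = (index_cube n (M k) \<inter> index_box n N) \<union> (A k \<inter> index_box n N)"
      by (auto simp: A_def)
    moreover have "(index_cube n (M k) \<inter> index_box n N) \<inter> (A k \<inter> index_box n N) = {}"
      by (auto simp: A_def)
    ultimately have "trig_poly n (index_cube n (M (Suc k)) \<inter> index_box n N) a \<theta>
        = trig_poly n (index_cube n (M k) \<inter> index_box n N) a \<theta> + T k N"
      by (simp add: trig_poly_def T_def sum.union_disjoint finite_index_box)
    then show ?case by (simp add: Suc.IH)
  qed
  \<comment> \<open>A box is finite, hence inside some cube, and k \<le> M k by strict monotonicity.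
    Taking \<open>k\<close> beyond a given \<open>m\<close> allows the sum to be split at
    \<open>m\<close>.\<close>
  have S: "\<exists>k\<ge>m. rect_partial_sum n a \<theta> N = (\<Sum>i<k. T i N)" for m N
  proof -
    obtain k where k: "k > m" "index_box n N \<subseteq> index_cube n k"
      using finite_subset_index_cube[OF finite_index_box index_box_subset] by blast
    have "index_cube n k \<subseteq> index_cube n (M k)"
      using M(2) by (intro index_cube_mono strict_mono_imp_increasing)
    with k(2) have "index_box n N = index_cube n (M k) \<inter> index_box n N"
      by auto
    then show ?thesis
      using sum_T[of k N] k(1) by (auto simp: rect_partial_sum_eq intro!: exI[of _ k])
  qed
  have "norm (rect_partial_sum n a \<theta> N) \<le> suminf u" for N
  proof -
    obtain k where k: "rect_partial_sum n a \<theta> N = (\<Sum>i<k. T i N)"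
      using S by blast
    have "norm (\<Sum>i<k. T i N) \<le> (\<Sum>i<k. u i)"
      by (rule sum_norm_le) (rule T_le)
    also have "\<dots> \<le> suminf u"
      by (rule sum_le_suminf[OF u]) (auto simp: u0)
    finally show ?thesis by (simp add: k)
  qed
  then have bdd: "bdd_above ((\<lambda>N. norm (rect_partial_sum n a \<theta> N)) ` multi_indices n)"
    by (auto simp: bdd_above_def)
  \<comment> \<open>One tail of \<open>u\<close> bounds the remaining blocks of the box sum, the
    other the remainder of the series \<open>t\<close>; hence the factor 2.\<close>
  have near: "norm (rect_partial_sum n a \<theta> N - suminf t) \<le> 2 * (suminf u - (\<Sum>i<m. u i))"
    if N: "\<And>j. j < n \<Longrightarrow> M m \<le> N j" for m N
  proof -
    obtain k where k: "k \<ge> m" "rect_partial_sum n a \<theta> N = (\<Sum>i<k. T i N)"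
      using S by blast
    have "T i N = t i" if "i < m" for i
    proof (rule T_eq)
      fix j
      assume "j < n"
      have "M (Suc i) \<le> M m"
        using M(2) that by (simp add: strict_mono_less_eq)
      with N[OF \<open>j < n\<close>] show "M (Suc i) \<le> N j" by simp
    qed
    then have "rect_partial_sum n a \<theta> N = (\<Sum>i<m. t i) + (\<Sum>i=m..<k. T i N)"
      using k by (simp add: sum.atLeastLessThan_concat[of 0 m k, symmetric] flip: atLeast0LessThan)
    moreover have "suminf t = (\<Sum>i<m. t i) + (\<Sum>i. t (i + m))"
      using suminf_split_initial_segment[OF t, of m] by simp
    ultimately have "norm (rect_partial_sum n a \<theta> N - suminf t)
        \<le> norm (\<Sum>i=m..<k. T i N) + norm (\<Sum>i. t (i + m))"
      by (simp add: norm_triangle_ineq4)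
    also have "norm (\<Sum>i=m..<k. T i N) \<le> (\<Sum>i=m..<k. u i)"
      by (rule sum_norm_le) (rule T_le)
    also have "\<dots> = (\<Sum>i<k. u i) - (\<Sum>i<m. u i)"
      using k(1) by (simp add: sum_diff_nat_ivl flip: atLeast0LessThan)
    also have "(\<Sum>i<k. u i) \<le> suminf u"
      by (rule sum_le_suminf[OF u]) (auto simp: u0)
    also have "norm (\<Sum>i. t (i + m)) \<le> (\<Sum>i. u (i + m))"
      by (rule norm_suminf_le[OF t_le]) (use u in \<open>simp add: summable_iff_shift\<close>)
    also have "\<dots> = suminf u - (\<Sum>i<m. u i)"
      by (rule suminf_minus_initial_segment[OF u])
    finally show ?thesis by simp
  qed
  have "(rect_partial_sum n a \<theta> \<longlongrightarrow> suminf t) (pringsheim_at_top n)"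
  proof (rule tendstoI)
    fix e :: real
    assume e: "e > 0"
    have "(\<lambda>m. \<Sum>i<m. u i) \<longlonglongrightarrow> suminf u"
      using u by (rule summable_LIMSEQ)
    then have "\<forall>\<^sub>F m in sequentially. dist (\<Sum>i<m. u i) (suminf u) < e / 2"
      using e by (intro tendstoD) auto
    then obtain m where m: "dist (\<Sum>i<m. u i) (suminf u) < e / 2"
      using eventually_sequentially by auto
    show "\<forall>\<^sub>F N in pringsheim_at_top n. dist (rect_partial_sum n a \<theta> N) (suminf t) < e"
      using eventually_pringsheim_at_top[of n "M m"]
    proof eventually_elim
      case (elim N)
      then show ?case
        using near[of m N] m by (simp add: dist_norm abs_if split: if_splits)
    qed
  qed
  with bdd show ?thesis
    unfolding pringsheim_convergent_def by blast
qed

theorem theorem1: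
  fixes n :: nat
    and a :: "(nat \<Rightarrow> nat) \<Rightarrow> 'h::complex_hilbert_space"
  assumes "n \<ge> 1"
    and "a \<in> dirichlet_space n"
  shows "quasi_everywhere n (\<lambda>\<theta>. pringsheim_convergent n a \<theta>)"
proof -
  \<comment> \<open>Weighting by square roots turns the Dirichlet condition into square summability
    of \<open>b\<close>.\<close>
  define b where "b = (\<lambda>\<alpha>. sqrt (dirichlet_weight n \<alpha>) *\<^sub>R a \<alpha>)"
  define f where "f \<alpha> = (norm (b \<alpha>))\<^sup>2" for \<alpha>
  have "f \<alpha> = (\<Prod>j<n. real (\<alpha> j + 1)) * (norm (a \<alpha>))\<^sup>2" for \<alpha>
    using dirichlet_weight_pos[of n \<alpha>]
    by (simp add: f_def b_def power_mult_distrib) (simp add: dirichlet_weight_def)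
  then have "f = (\<lambda>\<alpha>. (\<Prod>j<n. real (\<alpha> j + 1)) * (norm (a \<alpha>))\<^sup>2)"
    by (rule ext)
  then have f: "f summable_on multi_indices n"
    using assms(2) unfolding dirichlet_space_def by simp
  have f0: "f \<alpha> \<ge> 0" for \<alpha>
    by (simp add: f_def)
  \<comment> \<open>The \<open>+ 1\<close> keeps every tolerance \<open>C * (1 / 4) ^ m\<close>
    positive even if all coefficients vanish.\<close>
  define C where "C = infsum f (multi_indices n) + 1"
  have C: "C > 0"
    using infsum_nonneg[of "multi_indices n" f] f0 by (simp add: C_def add_nonneg_pos)
  let ?P = "\<lambda>m M. (m = 0 \<longrightarrow> M = 0) \<and>
      (\<forall>A. finite A \<longrightarrow> A \<subseteq> multi_indices n - index_cube n M \<longrightarrow> sum f A \<le> C * (1 / 4) ^ m)"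
  have "\<exists>M. \<forall>m. ?P m (M m) \<and> M m < M (Suc m)"
  proof (rule dependent_nat_choice)
    \<comment> \<open>For m = 0 the side is 0 and the tolerance is \<open>C\<close>, which exceeds
      the whole sum of \<open>f\<close>.\<close>
    have "sum f A \<le> C" if "finite A" "A \<subseteq> multi_indices n" for A
      using finite_sum_le_infsum[OF f that] f0 by (simp add: C_def add_increasing2)
    then show "\<exists>M. ?P 0 M"
      by (intro exI[of _ 0]) auto
    show "\<exists>M'. ?P (Suc m) M' \<and> M < M'" for M m
      using summable_on_multi_indices_tail[OF f f0, of "C * (1 / 4) ^ Suc m" M] C by auto
  qed
  then obtain M where "\<forall>m. ?P m (M m) \<and> M m < M (Suc m)"
    by (rule exE)
  note M = spec[OF this, THEN conjunct1] spec[OF this, THEN conjunct2]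
  define A where "A m = index_cube n (M (Suc m)) - index_cube n (M m)" for m
  have A: "finite (A m)" "A m \<subseteq> multi_indices n" for m
    using index_cube_subset[of n] by (auto simp: A_def finite_index_cube)
  define p where "p m \<psi> = norm (trig_poly n (A m) b \<psi>)" for m \<psi>
  have p[measurable]: "p m \<in> borel_measurable (torus_borel n)" for m
    unfolding p_def by measurable
  define w where "w \<psi> = (\<Sum>m. ennreal (p m \<psi>))" for \<psi>
  have w: "w \<in> borel_measurable (torus_borel n)"
    unfolding w_def by measurable
  have "(\<integral>\<^sup>+\<psi>. (w \<psi>)\<^sup>2 \<partial>torus_borel n) < \<infinity>"
    unfolding w_def
  proof (rule nn_integral_suminf_sq_finite)
    fix m
    have "sum f (A m) \<le> C * (1 / 4) ^ m"
      using M(1)[of m] A[of m] by (auto simp: A_def)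
    then show "(\<integral>\<^sup>+\<psi>. ennreal ((p m \<psi>)\<^sup>2) \<partial>torus_borel n) \<le> ennreal (C * (1 / 4) ^ m)"
      unfolding p_def nn_integral_norm_trig_poly_sq[OF A] f_def by (rule ennreal_leI)
  qed (use C in \<open>auto simp: p_def\<close>)
  then have "capacity n {\<theta>\<in>torus n. potential n w \<theta> = \<infinity>} = 0"
    by (intro capacity_eq_0_if_potential_top[OF w]) auto
  moreover have "pringsheim_convergent n a \<theta>" if fin: "potential n w \<theta> \<noteq> \<infinity>" for \<theta>
  proof -
    \<comment> \<open>\<open>v m\<close> bounds block \<open>m\<close> for all boxes at once. By
      monotone convergence these bounds add up to a multiple of the potential of \<open>w\<close>,
      which is finite at this \<theta>.\<close>
    define v where "v m = ennreal (4 ^ n) * potential n (\<lambda>\<psi>. ennreal (p m \<psi>)) \<theta>" for m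
    have "suminf v = ennreal (4 ^ n) * potential n w \<theta>"
      unfolding v_def w_def by (subst potential_suminf) simp_all
    then have v: "suminf v < top"
      using fin by (simp add: ennreal_mult_less_top top.not_eq_extremum)
    \<comment> \<open>\<open>enn2real\<close> sends \<infinity> to 0; finiteness of the total
      excludes that case, so no bound is lost in passing to real numbers.\<close>
    have v': "ennreal (enn2real (v m)) = v m" for m
      using ennreal_suminf_lessD[OF v, of m] by simp
    have sums: "summable (\<lambda>m. enn2real (v m))"
      using v by (intro summable_suminf_not_top) (auto simp: v')
    show ?thesis
    proof (rule pringsheim_convergent_if_blocks_summable[OF assms(1) _ _ sums])
      show "M 0 = 0" using M(1)[of 0] by simp
      show "strict_mono M" using M(2) by (simp add: strict_mono_Suc_iff)
      fix m N
      have "ennreal (norm (trig_poly n (A m \<inter> index_box n N) a \<theta>)) \<le> ennreal (enn2real (v m))"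
        using norm_trig_poly_index_box_le_potential[OF A, of m N a \<theta>] 
        unfolding v' unfolding v_def p_def b_def .
      then show "norm (trig_poly n ((index_cube n (M (Suc m)) - index_cube n (M m)) \<inter> index_box n N) a \<theta>) \<le> enn2real (v m)"
        by (simp add: A_def)
    qed
  qed
  ultimately show ?thesis
    unfolding quasi_everywhere_def
    by (intro exI[of _ "{\<theta>\<in>torus n. potential n w \<theta> = \<infinity>}"]) auto
qed

end
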